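(* Let $\mathbb{K}$ be a field of characteristic $0$, let $S=\mathbb{K}[x_1,\dots,x_l]$ with the standard grading, let $I$ be a homogeneous ideal of $S$, and let $\ell\in S_1$ be a linear form. Then the graded ring $S/I$ has the weak Lefschetz property (WLP) with weak Lefschetz element $\ell$ if and only if for every $d\ge 0$ $$\operatorname{HF}(S/(I+\langle \ell\rangle),d)=\max\{\operatorname{HF}(S/I,d)-\operatorname{HF}(S/I,d-1),\,0\},$$ where $\operatorname{HF}(S/I,-1)=0$.
   Context: $\operatorname{HF}(S/I,d)=\dim_{\mathbb{K}}(S/I)_d$ is the Hilbert function. A linear map between finite-dimensional spaces is full-rank if it is injective or surjective. A graded ring $R=\bigoplus_{i\ge0}R_i$ over $\mathbb{K}$ with $\dim_{\mathbb{K}}R_i<\infty$ (not necessarily Artinian) has the WLP with weak Lefschetz element $\ell\in R_1$ if the multiplication map $\times\ell\colon R_i\to R_{i+1}$ is full-rank for every $i\ge0$. For $R=S/I$, a linear form of $S$ is identified with its class in $R_1$. *)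

theory Defs
  imports "HOL-Library.Poly_Mapping" "HOL-Algebra.QuotRing" "Jordan_Normal_Form.VS_Connect"
begin

text \<open>Exponent vectors are finitely supported maps \<open>nat \<Rightarrow>\<^sub>0 nat\<close>, so the type \<open>'k mpoly\<close> is the
  polynomial ring in variables indexed by all natural numbers, with the convolution product of
  \<^theory>\<open>HOL-Library.Poly_Mapping\<close>.\<close>

type_synonym 'k mpoly = "(nat \<Rightarrow>\<^sub>0 nat) \<Rightarrow>\<^sub>0 'k"

definition poly_ring :: "nat \<Rightarrow> 'k::field mpoly ring" where
  "poly_ring l = class_ring\<lparr>carrier := {p. \<forall>m \<in> Poly_Mapping.keys p. Poly_Mapping.keys m \<subseteq> {1..l}}\<rparr>"

definition total_degree :: "(nat \<Rightarrow>\<^sub>0 nat) \<Rightarrow> nat" where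
  "total_degree m = (\<Sum>i \<in> Poly_Mapping.keys m. Poly_Mapping.lookup m i)"

definition poly_part :: "nat \<Rightarrow> nat \<Rightarrow> 'k::field mpoly set" where
  "poly_part l d = {p \<in> carrier (poly_ring l). \<forall>m \<in> Poly_Mapping.keys p. total_degree m = d}"

definition homogeneous_ideal :: "nat \<Rightarrow> 'k::field mpoly set \<Rightarrow> bool" where
  "homogeneous_ideal l I \<longleftrightarrow> (\<exists>G \<subseteq> (\<Union>d. poly_part l d). I = Idl\<^bsub>poly_ring l\<^esub> G)"

text \<open>The library quotient ring (its elements are the cosets of \<open>I\<close>), with the scalar
  multiplication coming from the inclusion of the constant polynomials.\<close>

definition quot_algebra :: "nat \<Rightarrow> 'k::field mpoly set \<Rightarrow> ('k, 'k mpoly set) module" where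
  "quot_algebra l I = (let Q = poly_ring l Quot I in
     \<lparr>carrier = carrier Q, monoid.mult = monoid.mult Q, one = one Q, zero = zero Q, add = add Q,
      smult = (\<lambda>c Y. (I +>\<^bsub>poly_ring l\<^esub> Poly_Mapping.single 0 c) \<otimes>\<^bsub>Q\<^esub> Y)\<rparr>)"

definition quot_part :: "nat \<Rightarrow> 'k::field mpoly set \<Rightarrow> nat \<Rightarrow> 'k mpoly set set" where
  "quot_part l I d = (\<lambda>p. I +>\<^bsub>poly_ring l\<^esub> p) ` poly_part l d"

text \<open>The degree is an integer so that the value at \<open>-1\<close> makes sense. The constant
  \<open>vectorspace.dim\<close> is only meaningful on finite-dimensional spaces; all graded pieces here are.\<close>

definition hilbert_fun :: "nat \<Rightarrow> 'k::field mpoly set \<Rightarrow> int \<Rightarrow> nat" where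
  "hilbert_fun l I d = (if d < 0 then 0
     else vectorspace.dim class_ring ((quot_algebra l I)\<lparr>carrier := quot_part l I (nat d)\<rparr>))"

definition full_rank :: "('a \<Rightarrow> 'b) \<Rightarrow> 'a set \<Rightarrow> 'b set \<Rightarrow> bool" where
  "full_rank f V W \<longleftrightarrow> inj_on f V \<or> f ` V = W"

text \<open>\<open>P i\<close> is the degree-\<open>i\<close> piece of the graded ring \<open>R\<close>.\<close>

definition has_WLP :: "('a, 'm) ring_scheme \<Rightarrow> (nat \<Rightarrow> 'a set) \<Rightarrow> 'a \<Rightarrow> bool" where
  "has_WLP R P x \<longleftrightarrow> x \<in> P 1 \<and> (\<forall>i. full_rank (\<lambda>y. x \<otimes>\<^bsub>R\<^esub> y) (P i) (P (i + 1)))"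

end

theory Submission
  imports Defs
begin

text \<open>Let \<open>J = I + \<langle>h\<rangle>\<close>. For every \<open>d\<close> the sequence
  \<open>(S/I)\<^sub>d \<longlongrightarrow> (S/I)\<^sub>d\<^sub>+\<^sub>1 \<longlongrightarrow> (S/J)\<^sub>d\<^sub>+\<^sub>1 \<longlongrightarrow> 0\<close>, whose first map is multiplication
  by \<open>h\<close> and whose second map is the projection, is exact. By rank-nullity the dimension of the
  last space is \<open>dim (S/I)\<^sub>d\<^sub>+\<^sub>1\<close> minus the rank of the multiplication, so the multiplication has the
  largest possible rank iff this difference is \<open>max (dim (S/I)\<^sub>d\<^sub>+\<^sub>1 - dim (S/I)\<^sub>d) 0\<close>. In degree
  \<open>0\<close> the condition always holds, because \<open>h\<close> has degree \<open>1\<close> and thus \<open>(S/J)\<^sub>0 = (S/I)\<^sub>0\<close>.\<close>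

section \<open>Full-rank maps and cokernels\<close>

text \<open>Independence in \<open>N\<close> and in the whole space agree, so independent subsets of
  \<open>N\<close> have at most \<open>dim\<close> elements. A maximal one is a finite basis of
  \<open>N\<close>.\<close>

lemma (in vectorspace) subspace_fin_dim:
  assumes fd: "fin_dim" and N: "subspace K N V"
  shows "vectorspace.fin_dim K (vs N)"
proof -
  interpret N: vectorspace K "vs N" by (rule subspace_is_vs[OF N])
  have sub: "submodule K N V" using N by (rule is_module)
  have NV: "N \<subseteq> carrier V" using sub by (simp add: submodule_def)
  have bound: "finite A \<and> card A \<le> dim" if "A \<subseteq> N \<and> N.lin_indpt A" for A
  proof -
    have "lin_indpt A" using that span_li_not_depend(2)[OF _ sub, of A] by simp
    then show ?thesis using li_le_dim[OF fd, of A] that NV by auto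
  qed
  have "N.lin_indpt {}" by (simp add: N.lin_dep_def)
  then obtain A where "finite A" "maximal A (\<lambda>A. A \<subseteq> N \<and> N.lin_indpt A)"
    using maximal_exists[where P = "\<lambda>A. A \<subseteq> N \<and> N.lin_indpt A", OF bound] by blast
  then have "finite A" "N.basis A" using N.max_li_is_basis[of A] by simp_all
  then show ?thesis by (auto simp: N.fin_dim_def N.basis_def)
qed

text \<open>A finite basis with \<open>dim = 0\<close> elements is empty, and the empty set spans
  only zero.\<close>

lemma (in vectorspace) dim_zero_carrier:
  assumes "fin_dim" "dim = 0"
  shows "carrier V = {\<zero>\<^bsub>V\<^esub>}"
proof -
  obtain b where b: "finite b" "basis b" using finite_basis_exists assms(1) by blast
  then have "b = {}" using dim_basis[of b] assms(2) by simp
  then show ?thesis using b span_empty by (simp add: basis_def)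
qed

text \<open>The kernel inherits finite dimension from the domain, so dimension \<open>0\<close>
  really forces it to be trivial.\<close>

lemma (in linear_map) inj_iff_dim_ker:
  assumes "V.fin_dim"
  shows "inj_on T (carrier V) \<longleftrightarrow> vectorspace.dim K (V.vs kerT) = 0"
proof
  assume "vectorspace.dim K (V.vs kerT) = 0"
  then have "carrier (V.vs kerT) = {\<zero>\<^bsub>V\<^esub>}"
    using vectorspace.dim_zero_carrier[OF V.subspace_is_vs V.subspace_fin_dim[OF assms]]
    by (simp add: kerT_is_subspace)
  then show "inj_on T (carrier V)" by (rule Ke0_imp_inj)
qed (rule inj_imp_dim_ker0)

text \<open>The hypotheses say that \<open>U \<rightarrow> V \<rightarrow> W \<rightarrow> 0\<close>
  is exact. Rank-nullity for \<open>T\<close> and for \<open>P\<close> expresses all three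
  dimensions through the rank and nullity of \<open>T\<close> and \<open>dim W\<close>.\<close>

lemma full_rank_iff_dim_cokernel:
  assumes T: "linear_map K U V T" and P: "linear_map K V W P"
    and fdU: "vectorspace.fin_dim K U" and fdV: "vectorspace.fin_dim K V"
    and onto: "P ` carrier V = carrier W"
    and exact: "\<And>v. v \<in> carrier V \<Longrightarrow> P v = \<zero>\<^bsub>W\<^esub> \<longleftrightarrow> v \<in> T ` carrier U"
  shows "full_rank T (carrier U) (carrier V) \<longleftrightarrow>
    int (vectorspace.dim K W) = max (int (vectorspace.dim K V) - int (vectorspace.dim K U)) 0"
proof -
  interpret T: linear_map K U V T by (rule T)
  interpret P: linear_map K V W P by (rule P)
  have im: "T.imT = P.kerT"
    using exact T.f_im by (auto simp: T.im_def P.ker_def)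
  have imP: "P.imT = carrier W" by (simp add: onto P.im_def)
  \<comment> \<open>By exactness \<open>r\<close> is both the rank of \<open>T\<close> and the
    nullity of \<open>P\<close>; \<open>k\<close> is the nullity of \<open>T\<close>.\<close>
  define r where "r = vectorspace.dim K (T.W.vs P.kerT)"
  define k where "k = vectorspace.dim K (T.V.vs T.kerT)"
  have rU: "r + k = vectorspace.dim K U"
    using T.rank_nullity[OF fdU] by (simp add: im r_def k_def)
  have rV: "vectorspace.dim K W + r = vectorspace.dim K V"
    using P.rank_nullity[OF fdV] by (simp add: imP r_def)
  have inj: "inj_on T (carrier U) \<longleftrightarrow> k = 0"
    unfolding k_def by (rule T.inj_iff_dim_ker[OF fdU])
  have surj: "T ` carrier U = carrier V \<longleftrightarrow> vectorspace.dim K W = 0"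
  proof
    assume "T ` carrier U = carrier V"
    then have "P.kerT = carrier V" using im by (simp add: T.im_def)
    then have "r = vectorspace.dim K V" by (simp add: r_def)
    then show "vectorspace.dim K W = 0" using rV by simp
  next
    assume "vectorspace.dim K W = 0"
    then have "carrier W = {\<zero>\<^bsub>W\<^esub>}"
      by (intro P.W.dim_zero_carrier P.surj_fin_dim[OF fdV onto])
    then have "P v = \<zero>\<^bsub>W\<^esub>" if "v \<in> carrier V" for v
      using that onto by blast
    then show "T ` carrier U = carrier V" using exact T.f_im by blast
  qed
  \<comment> \<open>Here \<open>dim V - dim U = dim W - k\<close>, and
    \<open>dim W = max (dim W - k) 0\<close> holds iff \<open>k = 0\<close> or
    \<open>dim W = 0\<close>.\<close>
  show ?thesis unfolding full_rank_def inj surj using rU rV by auto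
qed

section \<open>Polynomials and homogeneous components\<close>

lemma poly_ring_simps [simp]:
  "mult (poly_ring l) = (*)" "add (poly_ring l) = (+)"
  "one (poly_ring l) = 1" "zero (poly_ring l) = 0"
  by (simp_all add: poly_ring_def)

lemma mem_poly_ring:
  "p \<in> carrier (poly_ring l) \<longleftrightarrow> (\<forall>m \<in> Poly_Mapping.keys p. Poly_Mapping.keys m \<subseteq> {1..l})"
  by (simp add: poly_ring_def)

lemma keys_uminus [simp]: "Poly_Mapping.keys (- p) = Poly_Mapping.keys p"
  for p :: "'a \<Rightarrow>\<^sub>0 'b::ab_group_add"
  by (auto simp: in_keys_iff)

lemma poly_ring_add: "p + q \<in> carrier (poly_ring l)"
  if "p \<in> carrier (poly_ring l)" "q \<in> carrier (poly_ring l)"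
  using that Poly_Mapping.keys_add[of p q] unfolding mem_poly_ring by blast

lemma poly_ring_mult: "p * q \<in> carrier (poly_ring l)"
  if "p \<in> carrier (poly_ring l)" "q \<in> carrier (poly_ring l)"
  unfolding mem_poly_ring
proof
  fix m assume "m \<in> Poly_Mapping.keys (p * q)"
  then obtain a b where "m = a + b" "a \<in> Poly_Mapping.keys p" "b \<in> Poly_Mapping.keys q"
    using keys_mult[of p q] by blast
  then show "Poly_Mapping.keys m \<subseteq> {1..l}"
    using that Poly_Mapping.keys_add[of a b] unfolding mem_poly_ring by blast
qed

lemma poly_ring_zero: "0 \<in> carrier (poly_ring l)"
  by (simp add: mem_poly_ring)

lemma poly_ring_one: "1 \<in> carrier (poly_ring l)"
  by (simp add: mem_poly_ring)

lemma poly_ring_uminus: "- p \<in> carrier (poly_ring l)" if "p \<in> carrier (poly_ring l)"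
  using that by (simp add: mem_poly_ring)

text \<open>The ring laws hold on the whole type \<open>'k mpoly\<close>; what remains is closure of
  the carrier under the operations.\<close>

lemma cring_poly_ring: "cring (poly_ring l :: 'k::field mpoly ring)"
proof (rule cringI)
  show "abelian_group (poly_ring l :: 'k mpoly ring)"
  proof (rule abelian_groupI)
    fix p :: "'k mpoly" assume "p \<in> carrier (poly_ring l)"
    then show "\<exists>q\<in>carrier (poly_ring l). q \<oplus>\<^bsub>poly_ring l\<^esub> p = \<zero>\<^bsub>poly_ring l\<^esub>"
      using poly_ring_uminus by force
  qed (simp_all add: poly_ring_add poly_ring_zero add.assoc add.commute)
  show "Group.comm_monoid (poly_ring l :: 'k mpoly ring)"
    by (rule comm_monoidI) (simp_all add: poly_ring_mult poly_ring_one mult.assoc mult.commute)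
qed (simp add: distrib_right)

lemma a_inv_poly_ring: "p \<in> carrier (poly_ring l) \<Longrightarrow> \<ominus>\<^bsub>poly_ring l\<^esub> p = - p"
proof -
  interpret cring "poly_ring l :: 'a mpoly ring" by (rule cring_poly_ring)
  assume "p \<in> carrier (poly_ring l)"
  then show ?thesis by (intro minus_equality) (simp_all add: mem_poly_ring)
qed

lemma a_minus_poly_ring: "q \<in> carrier (poly_ring l) \<Longrightarrow> p \<ominus>\<^bsub>poly_ring l\<^esub> q = p - q"
  by (simp add: a_minus_def a_inv_poly_ring)

section \<open>Degrees of monomials and graded pieces of the polynomial ring\<close>

lemma total_degree_superset:
  assumes "finite K" "Poly_Mapping.keys m \<subseteq> K"
  shows "total_degree m = (\<Sum>i\<in>K. Poly_Mapping.lookup m i)"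
  unfolding total_degree_def using assms
  by (intro sum.mono_neutral_left) (simp_all add: in_keys_iff)

text \<open>The defining sums of the three degrees run over different sets of variables; over the
  common superset \<open>?K\<close> they add termwise.\<close>

lemma total_degree_add: "total_degree (a + b) = total_degree a + total_degree b"
proof -
  let ?K = "Poly_Mapping.keys a \<union> Poly_Mapping.keys b"
  have K: "finite ?K" by simp
  show ?thesis
    unfolding total_degree_superset[OF K Poly_Mapping.keys_add] total_degree_superset[OF K Un_upper1]
      total_degree_superset[OF K Un_upper2]
    by (simp only: plus_poly_mapping.rep_eq sum.distrib)
qed

lemma total_degree_zero [simp]: "total_degree 0 = 0"
  by (simp add: total_degree_def)

lemma poly_part_subset: "poly_part l d \<subseteq> carrier (poly_ring l)"
  by (auto simp: poly_part_def)

lemma poly_part_zero: "0 \<in> poly_part l d"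
  by (simp add: poly_part_def poly_ring_zero)

lemma poly_part_add: "p + q \<in> poly_part l d" if "p \<in> poly_part l d" "q \<in> poly_part l d"
  using that Poly_Mapping.keys_add[of p q] by (auto simp: poly_part_def poly_ring_add)

lemma poly_part_diff: "p - q \<in> poly_part l d" if "p \<in> poly_part l d" "q \<in> poly_part l d"
proof -
  have "- q \<in> poly_part l d" using that by (simp add: poly_part_def poly_ring_uminus)
  then show ?thesis using poly_part_add[of p l d "- q"] that by simp
qed

lemma poly_part_mult: "p * q \<in> poly_part l (d + e)" if "p \<in> poly_part l d" "q \<in> poly_part l e"
proof -
  have "total_degree m = d + e" if m: "m \<in> Poly_Mapping.keys (p * q)" for m
  proof -
    obtain a b where "m = a + b" "a \<in> Poly_Mapping.keys p" "b \<in> Poly_Mapping.keys q"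
      using keys_mult[of p q] m by blast
    then show ?thesis
      using \<open>p \<in> _\<close> \<open>q \<in> _\<close> by (simp add: total_degree_add poly_part_def)
  qed
  then show ?thesis using that by (simp add: poly_part_def poly_ring_mult)
qed

lemma poly_part_single:
  "Poly_Mapping.single m c \<in> poly_part l (total_degree m)" if "Poly_Mapping.keys m \<subseteq> {1..l}"
  using that by (simp add: poly_part_def mem_poly_ring)

lemma single_zero_poly_part: "Poly_Mapping.single 0 c \<in> poly_part l 0"
  using poly_part_single[of 0 l c] by simp

section \<open>Homogeneous components of a polynomial\<close>

lemma poly_mapping_sum_single:
  "p = (\<Sum>m\<in>Poly_Mapping.keys p. Poly_Mapping.single m (Poly_Mapping.lookup p m))"
  by (rule poly_mapping_eqI) (simp add: lookup_sum lookup_single when_def in_keys_iff)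

text \<open>All terms of degree other than \<open>d\<close> are deleted, which gives an additive
  projection on the whole polynomial type.\<close>

definition hom_component :: "nat \<Rightarrow> 'k::field mpoly \<Rightarrow> 'k mpoly" where
  "hom_component d p = Poly_Mapping.mapp (\<lambda>m c. c when total_degree m = d) p"

lemma lookup_hom_component:
  "Poly_Mapping.lookup (hom_component d p) m = (Poly_Mapping.lookup p m when total_degree m = d)"
  by (simp add: hom_component_def lookup_mapp when_def in_keys_iff)

lemma hom_component_add: "hom_component d (p + q) = hom_component d p + hom_component d q"
  by (rule poly_mapping_eqI) (simp add: lookup_hom_component lookup_add when_add_distrib)

lemma hom_component_zero [simp]: "hom_component d 0 = 0"
  by (rule poly_mapping_eqI) (simp add: lookup_hom_component)

lemma hom_component_sum: "hom_component d (sum f A) = (\<Sum>a\<in>A. hom_component d (f a))"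
  by (induction A rule: infinite_finite_induct) (simp_all add: hom_component_add)

lemma hom_component_homogeneous:
  assumes "\<And>m. m \<in> Poly_Mapping.keys p \<Longrightarrow> total_degree m = e"
  shows "hom_component d p = (if d = e then p else 0)"
  by (rule poly_mapping_eqI) (use assms in \<open>auto simp: lookup_hom_component when_def in_keys_iff\<close>)

lemma hom_component_poly_part:
  "p \<in> poly_part l e \<Longrightarrow> hom_component d p = (if d = e then p else 0)"
  by (rule hom_component_homogeneous) (simp add: poly_part_def)

lemma hom_component_in_poly_part:
  "p \<in> carrier (poly_ring l) \<Longrightarrow> hom_component d p \<in> poly_part l d"
  by (auto simp: poly_part_def mem_poly_ring in_keys_iff lookup_hom_component)

text \<open>Both sides are additive in \<open>q\<close>, so it suffices to treat a single term; its
  product with \<open>g\<close> is homogeneous.\<close>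

lemma hom_component_mult_homogeneous:
  assumes g: "\<And>m. m \<in> Poly_Mapping.keys g \<Longrightarrow> total_degree m = e"
  shows "hom_component d (q * g) = (if e \<le> d then hom_component (d - e) q * g else 0)"
proof -
  have mono: "hom_component d (Poly_Mapping.single m c * g) =
    (if e \<le> d then hom_component (d - e) (Poly_Mapping.single m c) * g else 0)" for m c
  proof -
    have "total_degree k = total_degree m + e"
      if k: "k \<in> Poly_Mapping.keys (Poly_Mapping.single m c * g)" for k
    proof -
      obtain b where "k = m + b" "b \<in> Poly_Mapping.keys g"
        using keys_mult[of "Poly_Mapping.single m c" g] k by (auto split: if_splits)
      then show ?thesis using g by (simp add: total_degree_add)
    qed
    then have "hom_component d (Poly_Mapping.single m c * g) =
        (if d = total_degree m + e then Poly_Mapping.single m c * g else 0)"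
      by (rule hom_component_homogeneous)
    moreover have "hom_component (d - e) (Poly_Mapping.single m c) =
        (if d - e = total_degree m then Poly_Mapping.single m c else 0)"
      by (rule hom_component_homogeneous) (simp split: if_splits)
    \<comment> \<open>Subtraction on \<open>nat\<close> truncates at \<open>0\<close>, so
      \<open>d - e = total_degree m\<close> says the right thing only together with
      \<open>e \<le> d\<close>.\<close>
    moreover have "d = total_degree m + e \<longleftrightarrow> e \<le> d \<and> d - e = total_degree m" by linarith
    ultimately show ?thesis by simp
  qed
  let ?s = "\<lambda>m. Poly_Mapping.single m (Poly_Mapping.lookup q m)"
  have "hom_component d (q * g) = (\<Sum>m\<in>Poly_Mapping.keys q. hom_component d (?s m * g))"
    by (subst poly_mapping_sum_single[of q])
      (simp only: sum_distrib_right hom_component_sum)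
  also have "\<dots> = (if e \<le> d then (\<Sum>m\<in>Poly_Mapping.keys q. hom_component (d - e) (?s m)) * g else 0)"
    by (simp add: mono sum_distrib_right)
  also have "(\<Sum>m\<in>Poly_Mapping.keys q. hom_component (d - e) (?s m)) = hom_component (d - e) q"
    by (subst (3) poly_mapping_sum_single[of q]) (simp only: hom_component_sum)
  finally show ?thesis .
qed

lemma homogeneous_ideal_is_ideal:
  assumes "homogeneous_ideal l I"
  shows "ideal I (poly_ring l)"
proof -
  interpret cring "poly_ring l :: 'a mpoly ring" by (rule cring_poly_ring)
  obtain G where "G \<subseteq> (\<Union>d. poly_part l d)" "I = Idl\<^bsub>poly_ring l\<^esub> G"
    using assms by (auto simp: homogeneous_ideal_def)
  moreover have "(\<Union>d. poly_part l d) \<subseteq> carrier (poly_ring l)"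
    using poly_part_subset by blast
  ultimately show ?thesis using genideal_ideal by blast
qed

text \<open>An ideal \<open>H\<close> of polynomials whose components lie in \<open>I\<close> is
  shown to contain the homogeneous generators; since \<open>I\<close> is the least ideal containing
  them, \<open>I \<subseteq> H\<close>.\<close>

lemma homogeneous_ideal_hom_component:
  assumes I: "homogeneous_ideal l I" and p: "p \<in> I"
  shows "hom_component d p \<in> I"
proof -
  interpret cring "poly_ring l :: 'a mpoly ring" by (rule cring_poly_ring)
  interpret I: ideal I "poly_ring l" using I by (rule homogeneous_ideal_is_ideal)
  obtain G where G: "G \<subseteq> (\<Union>d. poly_part l d)" and IG: "I = Idl\<^bsub>poly_ring l\<^esub> G"
    using I by (auto simp: homogeneous_ideal_def)
  \<comment> \<open>Quantifying over all multiples makes \<open>H\<close> visibly an ideal.\<close>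
  define H where "H = {p \<in> carrier (poly_ring l).
    \<forall>d. \<forall>q\<in>carrier (poly_ring l). hom_component d (q * p) \<in> I}"
  have GC: "G \<subseteq> carrier (poly_ring l)" using G poly_part_subset by blast
  have "ideal H (poly_ring l)"
  proof (rule idealI)
    show "subgroup H (add_monoid (poly_ring l))"
    proof (rule add.subgroupI)
      show "H \<noteq> {}" using I.zero_closed by (auto simp: H_def poly_ring_zero intro!: exI[of _ 0])
      fix a b assume ab: "a \<in> H" "b \<in> H"
      then show "a \<oplus>\<^bsub>poly_ring l\<^esub> b \<in> H"
        using I.a_closed by (simp add: H_def distrib_left hom_component_add poly_ring_add)
      have "- a \<in> carrier (poly_ring l)" using ab by (simp add: H_def poly_ring_uminus)
      moreover have "hom_component d (q * (- a)) \<in> I" if "q \<in> carrier (poly_ring l)" for q d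
      proof -
        \<comment> \<open>The sign moves to the multiplier:
          \<open>q * (- a) = (- q) * a\<close>.\<close>
        have "- q \<in> carrier (poly_ring l)" using that by (rule poly_ring_uminus)
        then show ?thesis using ab unfolding H_def minus_mult_commute[of q a, symmetric] by blast
      qed
      ultimately show "\<ominus>\<^bsub>poly_ring l\<^esub> a \<in> H" using ab by (simp add: H_def a_inv_poly_ring)
    qed (auto simp: H_def)
    fix a x :: "'a mpoly" assume ax: "a \<in> H" "x \<in> carrier (poly_ring l)"
    then have "hom_component d (q * (x * a)) \<in> I" if "q \<in> carrier (poly_ring l)" for q d
      using that poly_ring_mult[of q l x] by (simp add: H_def mult.assoc[symmetric])
    then show "x \<otimes>\<^bsub>poly_ring l\<^esub> a \<in> H" "a \<otimes>\<^bsub>poly_ring l\<^esub> x \<in> H"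
      using ax poly_ring_mult[of x l a] by (simp_all add: H_def mult.commute[of a x])
  qed (rule ring_axioms)
  moreover have "G \<subseteq> H"
  proof
    fix g assume g: "g \<in> G"
    then obtain e where e: "g \<in> poly_part l e" using G by blast
    have gI: "g \<in> I" using g genideal_self[OF GC] IG by blast
    have "hom_component d (q * g) \<in> I" if "q \<in> carrier (poly_ring l)" for q d
    proof -
      \<comment> \<open>For a homogeneous generator every component of a multiple is again a
        multiple of \<open>g\<close>, or zero.\<close>
      have "hom_component (d - e) q * g \<in> I"
        using I.I_l_closed[OF gI, of "hom_component (d - e) q"]
          hom_component_in_poly_part[OF that] poly_part_subset by auto
      moreover have "hom_component d (q * g) = (if e \<le> d then hom_component (d - e) q * g else 0)"
        by (rule hom_component_mult_homogeneous) (use e in \<open>simp add: poly_part_def\<close>)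
      ultimately show ?thesis using I.zero_closed by simp
    qed
    then show "g \<in> H" using g GC by (auto simp: H_def)
  qed
  ultimately have "p \<in> H" using genideal_minimal p IG by blast
  \<comment> \<open>The multiplier \<open>1\<close> in the definition of \<open>H\<close> yields the
    components of \<open>p\<close> itself.\<close>
  moreover have "1 \<in> carrier (poly_ring l)" by (rule poly_ring_one)
  ultimately show ?thesis by (force simp: H_def)
qed

section \<open>Graded pieces of quotient algebras\<close>

lemma quot_algebra_simps:
  "carrier (quot_algebra l I) = carrier (poly_ring l Quot I)"
  "mult (quot_algebra l I) = mult (poly_ring l Quot I)"
  "one (quot_algebra l I) = one (poly_ring l Quot I)"
  "zero (quot_algebra l I) = zero (poly_ring l Quot I)"
  "add (quot_algebra l I) = add (poly_ring l Quot I)"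
  "smult (quot_algebra l I) =
    (\<lambda>c Y. (I +>\<^bsub>poly_ring l\<^esub> Poly_Mapping.single 0 c) \<otimes>\<^bsub>poly_ring l Quot I\<^esub> Y)"
  by (simp_all add: quot_algebra_def Let_def)

lemma carrier_Quot: "carrier (R Quot I) = (\<lambda>p. I +>\<^bsub>R\<^esub> p) ` carrier R"
  by (auto simp: FactRing_def A_RCOSETS_def')

text \<open>Asking only for an ideal lets the same facts serve both \<open>I\<close> and the sum of
  \<open>I\<close> with the ideal generated by \<open>h\<close>.\<close>

locale poly_ideal =
  fixes l :: nat and I :: "'k::field mpoly set"
  assumes is_ideal: "ideal I (poly_ring l)"
begin

sublocale P: cring "poly_ring l :: 'k mpoly ring" by (rule cring_poly_ring)
sublocale ideal I "poly_ring l :: 'k mpoly ring" by (rule is_ideal)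
sublocale Q: cring "poly_ring l Quot I" by (rule quotient_is_cring[OF cring_poly_ring])

abbreviation coset :: "'k mpoly \<Rightarrow> 'k mpoly set" where
  "coset p \<equiv> I +>\<^bsub>poly_ring l\<^esub> p"

abbreviation A where "A \<equiv> quot_algebra l I"

abbreviation part_space where "part_space d \<equiv> A\<lparr>carrier := quot_part l I d\<rparr>"

lemma coset_closed: "p \<in> carrier (poly_ring l) \<Longrightarrow> coset p \<in> carrier A"
  by (simp add: quot_algebra_simps carrier_Quot)

lemma coset_add:
  "p \<in> carrier (poly_ring l) \<Longrightarrow> q \<in> carrier (poly_ring l) \<Longrightarrow>
    coset p \<oplus>\<^bsub>A\<^esub> coset q = coset (p + q)"
  using ring_hom_add[OF rcos_ring_hom, of p q] by (simp add: quot_algebra_simps)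

lemma coset_mult:
  "p \<in> carrier (poly_ring l) \<Longrightarrow> q \<in> carrier (poly_ring l) \<Longrightarrow>
    coset p \<otimes>\<^bsub>A\<^esub> coset q = coset (p * q)"
  using ring_hom_mult[OF rcos_ring_hom, of p q] by (simp add: quot_algebra_simps)

lemma single_zero_closed: "Poly_Mapping.single 0 c \<in> carrier (poly_ring l)"
  using single_zero_poly_part poly_part_subset by blast

lemma coset_smult:
  "p \<in> carrier (poly_ring l) \<Longrightarrow> c \<odot>\<^bsub>A\<^esub> coset p = coset (Poly_Mapping.single 0 c * p)"
  using coset_mult[OF single_zero_closed, of p c] by (simp add: quot_algebra_simps)

lemma zero_A: "\<zero>\<^bsub>A\<^esub> = coset 0"
  using ring_hom_zero[OF rcos_ring_hom P.ring_axioms Q.ring_axioms] by (simp add: quot_algebra_simps)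

lemma coset_eq_iff:
  "p \<in> carrier (poly_ring l) \<Longrightarrow> q \<in> carrier (poly_ring l) \<Longrightarrow>
    coset p = coset q \<longleftrightarrow> p - q \<in> I"
  using P.quotient_eq_iff_same_a_r_cos[OF is_ideal, of p q] by (simp add: a_minus_poly_ring)

lemma coset_eq_zero_iff: "p \<in> carrier (poly_ring l) \<Longrightarrow> coset p = \<zero>\<^bsub>A\<^esub> \<longleftrightarrow> p \<in> I"
  using coset_eq_iff[of p 0] by (simp add: zero_A poly_ring_zero)

text \<open>The additive laws are those of the quotient ring. The scalar laws are checked on
  representatives, where a scalar acts as multiplication by a constant polynomial.\<close>

lemma vectorspace_quot_algebra: "vectorspace class_ring A"
proof -
  have "abelian_group A"
  proof (rule abelian_groupI)
    fix x assume "x \<in> carrier A"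
    then show "\<exists>y\<in>carrier A. y \<oplus>\<^bsub>A\<^esub> x = \<zero>\<^bsub>A\<^esub>"
      unfolding quot_algebra_simps by (intro bexI[of _ "\<ominus>\<^bsub>poly_ring l Quot I\<^esub> x"] Q.l_neg Q.a_inv_closed)
  qed (simp_all add: quot_algebra_simps Q.a_ac)
  moreover have "module_axioms class_ring A"
  proof (rule module_axioms.intro)
    fix a b :: 'k and x assume "x \<in> carrier A"
    then obtain p where p: "p \<in> carrier (poly_ring l)" and x: "x = coset p"
      by (auto simp: quot_algebra_simps carrier_Quot)
    note closed = p single_zero_closed poly_ring_mult[OF single_zero_closed p]
    show "a \<odot>\<^bsub>A\<^esub> x \<in> carrier A"
      by (simp add: x coset_smult coset_closed closed)
    show "(a \<oplus>\<^bsub>class_ring\<^esub> b) \<odot>\<^bsub>A\<^esub> x = a \<odot>\<^bsub>A\<^esub> x \<oplus>\<^bsub>A\<^esub> b \<odot>\<^bsub>A\<^esub> x"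
      by (simp add: x coset_smult coset_add closed single_add distrib_right)
    show "(a \<otimes>\<^bsub>class_ring\<^esub> b) \<odot>\<^bsub>A\<^esub> x = a \<odot>\<^bsub>A\<^esub> (b \<odot>\<^bsub>A\<^esub> x)"
      by (simp add: x coset_smult closed mult_single mult.assoc[symmetric])
    show "\<one>\<^bsub>class_ring\<^esub> \<odot>\<^bsub>A\<^esub> x = x"
      by (simp add: x coset_smult closed)
    fix y assume "y \<in> carrier A"
    then obtain q where q: "q \<in> carrier (poly_ring l)" and y: "y = coset q"
      by (auto simp: quot_algebra_simps carrier_Quot)
    show "a \<odot>\<^bsub>A\<^esub> (x \<oplus>\<^bsub>A\<^esub> y) = a \<odot>\<^bsub>A\<^esub> x \<oplus>\<^bsub>A\<^esub> a \<odot>\<^bsub>A\<^esub> y"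
      by (simp add: x y coset_smult coset_add closed q poly_ring_add poly_ring_mult distrib_left)
  qed
  ultimately show ?thesis
    by (intro vectorspace.intro Module.module.intro class_field class_cring.cring_axioms)
qed

sublocale V: vectorspace class_ring A by (rule vectorspace_quot_algebra)

lemma quot_partI: "p \<in> poly_part l d \<Longrightarrow> coset p \<in> quot_part l I d"
  by (simp add: quot_part_def)

lemma quot_partE:
  assumes "x \<in> quot_part l I d"
  obtains p where "p \<in> poly_part l d" "p \<in> carrier (poly_ring l)" "x = coset p"
  using assms poly_part_subset by (auto simp: quot_part_def)

lemma smult_poly_part: "p \<in> poly_part l d \<Longrightarrow> Poly_Mapping.single 0 c * p \<in> poly_part l d"
  using poly_part_mult[OF single_zero_poly_part, of p l d c] by simp

lemma subspace_quot_part: "subspace class_ring (quot_part l I d) A"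
proof (intro subspace.intro submodule.intro vectorspace_quot_algebra V.module_axioms)
  show "quot_part l I d \<subseteq> carrier A"
    using coset_closed poly_part_subset by (auto simp: quot_part_def)
  show "\<zero>\<^bsub>A\<^esub> \<in> quot_part l I d"
    using quot_partI[OF poly_part_zero] by (simp add: zero_A)
  fix v assume "v \<in> quot_part l I d"
  then obtain p where p: "p \<in> poly_part l d" "p \<in> carrier (poly_ring l)" "v = coset p"
    by (rule quot_partE)
  show "c \<odot>\<^bsub>A\<^esub> v \<in> quot_part l I d" for c
    using p by (simp add: coset_smult quot_partI smult_poly_part)
  fix w assume "w \<in> quot_part l I d"
  then obtain q where "q \<in> poly_part l d" "q \<in> carrier (poly_ring l)" "w = coset q"
    by (rule quot_partE)
  with p show "v \<oplus>\<^bsub>A\<^esub> w \<in> quot_part l I d"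
    by (simp add: coset_add quot_partI poly_part_add)
qed

lemma vectorspace_part_space: "vectorspace class_ring (part_space d)"
  by (rule V.subspace_is_vs[OF subspace_quot_part])

end

text \<open>Such a monomial is determined by its exponents on \<open>{1..l}\<close>, each at most
  \<open>d\<close>, so the monomials embed into a finite function space.\<close>

lemma finite_monomials: "finite {m. Poly_Mapping.keys m \<subseteq> {1..l} \<and> total_degree m = d}"
  (is "finite ?M")
proof (rule inj_on_finite)
  show "inj_on (\<lambda>m. restrict (Poly_Mapping.lookup m) {1..l}) ?M"
  proof (rule inj_onI)
    fix a b assume ab: "a \<in> ?M" "b \<in> ?M"
      and eq: "restrict (Poly_Mapping.lookup a) {1..l} = restrict (Poly_Mapping.lookup b) {1..l}"
    show "a = b"
    proof (rule poly_mapping_eqI)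
      fix i
      show "Poly_Mapping.lookup a i = Poly_Mapping.lookup b i"
      proof (cases "i \<in> {1..l}")
        case True
        then show ?thesis using fun_cong[OF eq, of i] by simp
      next
        case False
        then have "i \<notin> Poly_Mapping.keys a" "i \<notin> Poly_Mapping.keys b" using ab by blast+
        then show ?thesis by (simp add: in_keys_iff)
      qed
    qed
  qed
  show "(\<lambda>m. restrict (Poly_Mapping.lookup m) {1..l}) ` ?M \<subseteq> {1..l} \<rightarrow>\<^sub>E {..d}"
  proof clarify
    fix m :: "nat \<Rightarrow>\<^sub>0 nat" assume m: "Poly_Mapping.keys m \<subseteq> {1..l}" "d = total_degree m"
    have "Poly_Mapping.lookup m i \<le> total_degree m" for i
      by (cases "i \<in> Poly_Mapping.keys m")
        (simp_all add: total_degree_def member_le_sum not_in_keys_iff_lookup_eq_zero)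
    then show "restrict (Poly_Mapping.lookup m) {1..l} \<in> {1..l} \<rightarrow>\<^sub>E {..total_degree m}" by auto
  qed
qed (simp add: finite_PiE)

context poly_ideal
begin

text \<open>The classes of the finitely many monomials of degree \<open>d\<close> span the piece.
  This gives \<open>dim\<close> its meaning and makes rank-nullity applicable.\<close>

lemma fin_dim_part_space: "vectorspace.fin_dim class_ring (part_space d)"
proof -
  interpret S: vectorspace class_ring "part_space d" by (rule vectorspace_part_space)
  define M where "M = {m. Poly_Mapping.keys m \<subseteq> {1..l} \<and> total_degree m = d}"
  define B where "B = (\<lambda>m. coset (Poly_Mapping.single m 1)) ` M"
  have mono: "Poly_Mapping.single m c \<in> poly_part l d" if "m \<in> M" for m c
    using that poly_part_single[of m l c] by (simp add: M_def)
  have B: "B \<subseteq> quot_part l I d" unfolding B_def using mono quot_partI by blast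
  then have "B \<subseteq> carrier (part_space d)" by simp
  note sub = S.span_is_submodule[OF this] and own = S.in_own_span[OF this]
  \<comment> \<open>Membership in the carrier is carried through the induction because
    \<open>coset_add\<close> requires it of both summands.\<close>
  have sum: "coset (\<Sum>m\<in>N. Poly_Mapping.single m (c m)) \<in> S.span B \<and>
    (\<Sum>m\<in>N. Poly_Mapping.single m (c m)) \<in> carrier (poly_ring l)"
    if "finite N" "N \<subseteq> M" for N c
    using that
  proof (induction N)
    case empty
    then show ?case using submodule.zero_closed[OF sub] by (simp add: zero_A poly_ring_zero)
  next
    case (insert m N)
    have m: "Poly_Mapping.single m a \<in> carrier (poly_ring l)" for a
      using insert.prems mono poly_part_subset by blast
    have "coset (Poly_Mapping.single m 1) \<in> S.span B" using own insert.prems by (auto simp: B_def)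
    then have "c m \<odot>\<^bsub>A\<^esub> coset (Poly_Mapping.single m 1) \<in> S.span B"
      using submodule.smult_closed[OF sub, of "c m"] by simp
    then have "coset (Poly_Mapping.single m (c m)) \<in> S.span B"
      by (simp add: coset_smult m mult_single)
    then show ?case
      using insert submodule.m_closed[OF sub] by (simp add: coset_add[symmetric] poly_ring_add m)
  qed
  have "carrier (part_space d) \<subseteq> S.span B"
  proof
    fix x assume "x \<in> carrier (part_space d)"
    then obtain p where "p \<in> poly_part l d" "x = coset p"
      by (auto elim: quot_partE)
    moreover from this have "Poly_Mapping.keys p \<subseteq> M"
      by (auto simp: M_def poly_part_def mem_poly_ring)
    ultimately show "x \<in> S.span B"
      using sum[of "Poly_Mapping.keys p" "Poly_Mapping.lookup p"]
      by (simp flip: poly_mapping_sum_single)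
  qed
  moreover have "S.span B \<subseteq> carrier (part_space d)" using B by (intro S.span_is_subset2) simp
  moreover have "finite B" using finite_monomials by (simp add: B_def M_def)
  ultimately show ?thesis using B unfolding S.fin_dim_def by (intro exI[of _ B]) auto
qed

lemma hilbert_fun_part_space:
  "hilbert_fun l I (int d) = vectorspace.dim class_ring (part_space d)"
  by (simp add: hilbert_fun_def)

text \<open>Multiplication by a form of degree \<open>1\<close> raises the degree by one.
  Distributivity gives additivity, and commutativity moves the scalar past \<open>h\<close>.\<close>

lemma linear_map_mult:
  assumes "h \<in> poly_part l 1"
  shows "linear_map class_ring (part_space d) (part_space (d + 1)) (\<lambda>y. coset h \<otimes>\<^bsub>A\<^esub> y)"
proof -
  have h: "h \<in> carrier (poly_ring l)" using assms poly_part_subset by blast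
  have hp: "h * p \<in> poly_part l (Suc d)" if "p \<in> poly_part l d" for p
    using poly_part_mult[OF assms that] by simp
  have "(\<lambda>y. coset h \<otimes>\<^bsub>A\<^esub> y) \<in> LinearCombinations.module_hom class_ring (part_space d) (part_space (d + 1))"
    unfolding LinearCombinations.module_hom_def
    by (auto elim!: quot_partE simp: coset_mult coset_add coset_smult h hp quot_partI poly_ring_add
      poly_ring_mult single_zero_closed distrib_left mult.left_commute)
  then show ?thesis
    using vectorspace_part_space[of d] vectorspace_part_space[of "d + 1"]
    by (intro linear_map.intro mod_hom.intro mod_hom_axioms.intro) (simp_all add: vectorspace_def)
qed

end

section \<open>The projection between two quotients\<close>

locale poly_ideal_pair = I: poly_ideal l I + J: poly_ideal l J
  for l and I J :: "'k::field mpoly set" +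
  assumes subset: "I \<subseteq> J"
begin

text \<open>The projection is given as \<open>X \<mapsto> J + X\<close> on cosets, which needs no
  choice of representatives; the summand \<open>I\<close> is absorbed by \<open>J\<close>.\<close>

lemma set_add_coset:
  assumes "p \<in> carrier (poly_ring l)"
  shows "J <+>\<^bsub>poly_ring l\<^esub> I.coset p = J.coset p"
proof
  show "J <+>\<^bsub>poly_ring l\<^esub> I.coset p \<subseteq> J.coset p"
  proof
    fix x assume "x \<in> J <+>\<^bsub>poly_ring l\<^esub> I.coset p"
    then obtain j i where "j \<in> J" "i \<in> I" "x = (j + i) + p"
      by (auto simp: set_add_def' a_r_coset_def' add.assoc)
    moreover from this have "j + i \<in> J" using J.a_closed[of j i] subset by auto
    ultimately show "x \<in> J.coset p" by (auto simp: a_r_coset_def')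
  qed
  show "J.coset p \<subseteq> J <+>\<^bsub>poly_ring l\<^esub> I.coset p"
    using I.zero_closed by (force simp: set_add_def' a_r_coset_def')
qed

lemma linear_map_projection:
  "linear_map class_ring (I.part_space d) (J.part_space d) (\<lambda>X. J <+>\<^bsub>poly_ring l\<^esub> X)"
proof -
  have "(\<lambda>X. J <+>\<^bsub>poly_ring l\<^esub> X) \<in>
      LinearCombinations.module_hom class_ring (I.part_space d) (J.part_space d)"
    unfolding LinearCombinations.module_hom_def
    by (auto elim!: I.quot_partE simp: I.coset_add J.coset_add I.coset_smult J.coset_smult
      J.quot_partI poly_ring_add poly_ring_mult I.single_zero_closed set_add_coset)
  then show ?thesis
    using I.vectorspace_part_space[of d] J.vectorspace_part_space[of d]
    by (intro linear_map.intro mod_hom.intro mod_hom_axioms.intro) (simp_all add: vectorspace_def)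
qed

lemma projection_onto:
  "(\<lambda>X. J <+>\<^bsub>poly_ring l\<^esub> X) ` carrier (I.part_space d) = carrier (J.part_space d)"
proof -
  have "J <+>\<^bsub>poly_ring l\<^esub> I.coset p = J.coset p" if "p \<in> poly_part l d" for p
    using that poly_part_subset set_add_coset by blast
  then show ?thesis by (simp add: quot_part_def image_image)
qed

end

text \<open>The degree-\<open>d\<close> component of \<open>i + q h\<close> is \<open>i\<^sub>d + q\<^sub>d\<^sub>-\<^sub>1 h\<close>, and
  \<open>i\<^sub>d \<in> I\<close> because \<open>I\<close> is homogeneous.\<close>

lemma poly_part_in_sum_ideal:
  assumes I: "homogeneous_ideal l I" and h: "h \<in> poly_part l 1"
    and p: "p \<in> poly_part l d" "p \<in> I <+>\<^bsub>poly_ring l\<^esub> Idl\<^bsub>poly_ring l\<^esub> {h}"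
  shows "\<exists>q\<in>carrier (poly_ring l).
    p - (if 1 \<le> d then hom_component (d - 1) q * h else 0) \<in> I"
proof -
  interpret cring "poly_ring l :: 'a mpoly ring" by (rule cring_poly_ring)
  have "h \<in> carrier (poly_ring l)" using h poly_part_subset by blast
  \<comment> \<open>In a commutative ring the ideal generated by \<open>h\<close> consists of the
    multiples of \<open>h\<close>.\<close>
  then have "Idl\<^bsub>poly_ring l\<^esub> {h} = {q * h |q. q \<in> carrier (poly_ring l)}"
    using cgenideal_eq_genideal[of h] by (simp add: cgenideal_def)
  then obtain i q where i: "i \<in> I" and q: "q \<in> carrier (poly_ring l)" and pq: "p = i + q * h"
    using p(2) by (auto simp: set_add_def')
  have "p = hom_component d p" using p(1) by (simp add: hom_component_poly_part)
  also have "\<dots> = hom_component d i + (if 1 \<le> d then hom_component (d - 1) q * h else 0)"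
    unfolding pq hom_component_add
    by (subst hom_component_mult_homogeneous[where e = 1]) (use h in \<open>simp_all add: poly_part_def\<close>)
  finally have "p - (if 1 \<le> d then hom_component (d - 1) q * h else 0) = hom_component d i"
    by (simp add: algebra_simps)
  then show ?thesis using q homogeneous_ideal_hom_component[OF I i, of d] by metis
qed

theorem proposition2p12:
  fixes l :: nat and I :: "'k::field_char_0 mpoly set" and h :: "'k mpoly"
  assumes "homogeneous_ideal l I" and "h \<in> poly_part l 1"
  shows "has_WLP (quot_algebra l I) (quot_part l I) (I +>\<^bsub>poly_ring l\<^esub> h) \<longleftrightarrow>
    (\<forall>d::nat. int (hilbert_fun l (I <+>\<^bsub>poly_ring l\<^esub> Idl\<^bsub>poly_ring l\<^esub> {h}) (int d)) =
       max (int (hilbert_fun l I (int d)) - int (hilbert_fun l I (int d - 1))) 0)"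
proof -
  interpret cring "poly_ring l :: 'k mpoly ring" by (rule cring_poly_ring)
  define J where "J = I <+>\<^bsub>poly_ring l\<^esub> Idl\<^bsub>poly_ring l\<^esub> {h}"
  note I = assms(1) and h = assms(2)
  have hC: "h \<in> carrier (poly_ring l)" using h poly_part_subset by blast
  have idI: "ideal I (poly_ring l)" using I by (rule homogeneous_ideal_is_ideal)
  have idh: "ideal (Idl\<^bsub>poly_ring l\<^esub> {h}) (poly_ring l)" using hC by (intro genideal_ideal) simp
  have idJ: "ideal J (poly_ring l)" unfolding J_def by (rule add_ideals[OF idI idh])
  have hJ: "h \<in> J"
    unfolding J_def set_add_def'
    using additive_subgroup.zero_closed[OF ideal.axioms(1)[OF idI]] genideal_self'[OF hC] by force
  interpret poly_ideal_pair l I J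
  proof (intro poly_ideal_pair.intro poly_ideal.intro poly_ideal_pair_axioms.intro idI idJ)
    show "I \<subseteq> J"
      unfolding J_def set_add_def'
      using additive_subgroup.zero_closed[OF ideal.axioms(1)[OF idh]] by force
  qed
  let ?T = "\<lambda>y. I.coset h \<otimes>\<^bsub>I.A\<^esub> y" and ?P = "\<lambda>X. J <+>\<^bsub>poly_ring l\<^esub> X"
  \<comment> \<open>Exactness in the middle. For \<open>v\<close> the class of \<open>p\<close>, the
    left side means \<open>p \<in> J\<close>.\<close>
  have exact: "?P v = \<zero>\<^bsub>J.part_space (d + 1)\<^esub> \<longleftrightarrow> v \<in> ?T ` carrier (I.part_space d)"
    if "v \<in> carrier (I.part_space (d + 1))" for v d
  proof -
    have "v \<in> quot_part l I (d + 1)" using that by simp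
    then obtain p where
      p: "p \<in> poly_part l (d + 1)" "p \<in> carrier (poly_ring l)" "v = I.coset p"
      by (rule I.quot_partE)
    have "p \<in> J" if "v \<in> ?T ` carrier (I.part_space d)"
    proof -
      obtain q where q: "q \<in> carrier (poly_ring l)" "v = I.coset (h * q)"
        using \<open>v \<in> ?T ` _\<close> hC by (auto elim!: I.quot_partE simp: I.coset_mult)
      \<comment> \<open>Equality of classes modulo \<open>I\<close> gives a difference in
        \<open>I\<close>, hence in \<open>J\<close>; the multiple \<open>h * q\<close> lies in
        \<open>J\<close> as well.\<close>
      then have "p - h * q \<in> J"
        using p hC subset I.coset_eq_iff[of p "h * q"] by (auto simp: poly_ring_mult)
      moreover have "h * q \<in> J" using J.I_r_closed[OF hJ q(1)] by simp
      ultimately show ?thesis using J.a_closed[of "p - h * q" "h * q"] by simp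
    qed
    moreover have "v \<in> ?T ` carrier (I.part_space d)" if pJ: "p \<in> J"
    proof -
      \<comment> \<open>The cofactor \<open>q\<close> may be inhomogeneous; its component of degree
        \<open>d\<close> provides the preimage.\<close>
      obtain q where q: "q \<in> carrier (poly_ring l)" and pq: "p - hom_component d q * h \<in> I"
        using poly_part_in_sum_ideal[OF I h p(1)] pJ by (auto simp: J_def)
      have qd: "hom_component d q \<in> poly_part l d" by (rule hom_component_in_poly_part[OF q])
      then have qC: "hom_component d q \<in> carrier (poly_ring l)" using poly_part_subset by blast
      have "v = ?T (I.coset (hom_component d q))"
        using p pq hC qC I.coset_eq_iff[of p "h * hom_component d q"]
        by (simp add: I.coset_mult poly_ring_mult mult.commute)
      then show ?thesis using I.quot_partI[OF qd] by auto
    qed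
    ultimately show ?thesis
      using p J.coset_eq_zero_iff[of p] by (auto simp: set_add_coset)
  qed
  have step: "full_rank ?T (quot_part l I d) (quot_part l I (d + 1)) \<longleftrightarrow>
    int (hilbert_fun l J (int (d + 1))) =
      max (int (hilbert_fun l I (int (d + 1))) - int (hilbert_fun l I (int d))) 0" for d
    using full_rank_iff_dim_cokernel[OF I.linear_map_mult[OF h] linear_map_projection
      I.fin_dim_part_space I.fin_dim_part_space projection_onto exact, of d]
    unfolding I.hilbert_fun_part_space J.hilbert_fun_part_space by simp
  have zero: "hilbert_fun l J (int 0) = hilbert_fun l I (int 0)"
  proof -
    have "inj_on ?P (carrier (I.part_space 0))"
    proof (rule inj_onI)
      fix x y assume "x \<in> carrier (I.part_space 0)" "y \<in> carrier (I.part_space 0)"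
        and eq: "?P x = ?P y"
      then have "x \<in> quot_part l I 0" "y \<in> quot_part l I 0" by simp_all
      then obtain p q where p: "p \<in> poly_part l 0" "p \<in> carrier (poly_ring l)" "x = I.coset p"
        and q: "q \<in> poly_part l 0" "q \<in> carrier (poly_ring l)" "y = I.coset q"
        by (meson I.quot_partE)
      have "p - q \<in> J" using eq p q by (simp add: set_add_coset J.coset_eq_iff)
      \<comment> \<open>In degree \<open>0\<close> no multiple of \<open>h\<close> contributes: the
        conditional term of \<open>poly_part_in_sum_ideal\<close> is \<open>0\<close>.\<close>
      then have "p - q \<in> I"
        using poly_part_in_sum_ideal[OF I h poly_part_diff[OF p(1) q(1)]] by (simp add: J_def)
      then show "x = y" using p q by (simp add: I.coset_eq_iff)
    qed
    from linear_map.dim_eq[OF linear_map_projection I.fin_dim_part_space this projection_onto]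
    show ?thesis unfolding I.hilbert_fun_part_space J.hilbert_fun_part_space by simp
  qed
  \<comment> \<open>The class of \<open>h\<close> lies in the piece of degree \<open>1\<close> by
    the choice of \<open>h\<close>, so only the full-rank conditions remain.\<close>
  have "has_WLP I.A (quot_part l I) (I.coset h) \<longleftrightarrow>
      (\<forall>d. full_rank ?T (quot_part l I d) (quot_part l I (d + 1)))"
    using I.quot_partI[OF h] by (simp add: has_WLP_def)
  also have "\<dots> \<longleftrightarrow> (\<forall>d. int (hilbert_fun l J (int (d + 1))) =
      max (int (hilbert_fun l I (int (d + 1))) - int (hilbert_fun l I (int (d + 1) - 1))) 0)"
    unfolding step by simp
  also have "\<dots> \<longleftrightarrow> (\<forall>d. int (hilbert_fun l J (int d)) =
      max (int (hilbert_fun l I (int d)) - int (hilbert_fun l I (int d - 1))) 0)"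
    (is "(\<forall>d. ?Q (d + 1)) \<longleftrightarrow> (\<forall>d. ?Q d)")
  proof -
    \<comment> \<open>The full-rank conditions cover only degrees \<open>d + 1\<close>. Since
      \<open>hilbert_fun\<close> is \<open>0\<close> at \<open>-1\<close>, the condition in degree
      \<open>0\<close> is the equality \<open>zero\<close>.\<close>
    have "?Q 0" using zero by (simp add: hilbert_fun_def)
    then show ?thesis by (metis Suc_eq_plus1 not0_implies_Suc)
  qed
  finally show ?thesis unfolding J_def .
qed

end
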